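(* Let $f:[\ell,u]\to\mathbb R$ be a nonlinear, bounded and differentiable univariate function that admits a base partition $p_f^0$, let $\mathcal X=\{(x,y)\in[\ell,u]\times\mathbb R: y=f(x)\}$, and let $p_0=p_f^0,p_1,p_2,\dots$ be any infinite sequence of partitions of $[\ell,u]$ generated by the maximal-bound interval-bisection procedure. Let $\operatorname{Proj}_{x,y}\mathcal R(f,p_k)$ be the projection onto the $(x,y)$-space of the MILP formulation $\mathcal R(f,p_k)$. Then $$\lim_{k\to\infty}\operatorname{Proj}_{x,y}\mathcal R(f,p_k)=\mathcal X,$$ where the convergence of sets is in the sense that $d_H\big(\operatorname{Proj}_{x,y}\mathcal R(f,p_k),\mathcal X\big)\to0$ as $k\to\infty$, with $d_H$ the Hausdorff distance.
   Context: Function: $f:[\ell,u]\to\mathbb R$ ($\ell<u$) is nonlinear (not affine), bounded and differentiable on $[\ell,u]$ (one-sided derivatives at the endpoints). Partitions: a partition $p$ of $[\ell,u]$ is a finite sequence $(x_0,\dots,x_k)$ with $\ell=x_0<x_1<\dots<x_k=u$; $\mathcal P(p)=\{x_0,\dots,x_k\}$; the intervals $[x_{i-1},x_i]$, $i=1,\dots,k$, are its sub-intervals. A break point of $f$ is a point of $[\ell,u]$ at which $f$ changes from convex to concave or vice versa. A base partition $p_f^0$ of $f$ is a partition such that (i) every break point of $f$ is in $\mathcal P(p_f^0)$, (ii) $f'(x_{i-1})\ne f'(x_i)$ for every sub-interval $[x_{i-1},x_i]$, and (iii) $|\mathcal P(p_f^0)|$ is minimum. To make it unique, one takes the break points of $f$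 together with $\ell,u$, and adds the midpoint of every resulting sub-interval at whose endpoints $f'$ takes equal values. It is assumed that $f$ has such a (finite) base partition and that $f$ is convex or concave on each of its sub-intervals. An interval bisection of a partition adds one new partition point, the midpoint of one of its sub-intervals. A partition is admissible for $f$ if it is $p_f^0$ or is obtained from $p_f^0$ by a finite sequence of interval bisections. MILP formulation: let $p=(x_0,\dots,x_k)$ be admissible. Let $\bm v_i=(x_i,f(x_i))$ for $i=0,\dots,k$, and for $i=1,\dots,k$ let $\bm v_{i-1,i}$ be the intersection point of the tangent lines to $y=f(x)$ at $\bm v_{i-1}$ and $\bm v_i$ (if these two tangents coincide, i.e. $f$ is affine on $[x_{i-1},x_i]$, $\bm v_{i-1,i}$ is taken to be any point of the segment from $\bm v_{i-1}$ to $\bm v_i$). Superscripts $x,y$ denote coordinates of a point. $\mathcal R(f,p)$ is the set of $(x,y,\bm\delta,\bm z)$, $\bm\delta=(\delta_1^i,\delta_2^i)_{i=1}^k$, $\bm z=(z_1,\dots,z_{k-1})$, satisfying $$y=v_0^y+\sum_{i=1}^k\{\delta_1^i(v_{i-1,i}^y-v_{i-1}^y)+\delta_2^i(v_i^y-v_{i-1}^y)\},$$ $$x=v_0^x+\sum_{i=1}^k\{\delta_1^i(v_{i-1,i}^x-v_{i-1}^x)+\delta_2^i(v_i^x-v_{i-1}^x)\},$$ $$\delta_1^1+\delta_2^1\le 1,\qquad \delta_1^i+\delta_2^i\le z_{i-1}\le\delta_2^{i-1}\ (i=2,\dots,k),$$ $$0\le\delta_1^i,\delta_2^i\le 1\ (i=1,\dots,k),\qquad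 z_i\in\{0,1\}\ (i=1,\dots,k-1).$$ $\operatorname{Proj}_{x,y}$ denotes projection onto the $(x,y)$ coordinates; $\operatorname{Proj}_{x,y}\mathcal R(f,p)$ is the union of the $k$ triangles with vertices $\bm v_{i-1},\bm v_i,\bm v_{i-1,i}$, $i=1,\dots,k$. Maximal-bound interval-bisection procedure: $p_0=p_f^0$. Given $p_k$, compute for each sub-interval $[a,b]$ of $p_k$ the number $\frac{(b-a)|f'(a)-f'(b)|}{4}$; choose a sub-interval for which this number is maximal (ties broken arbitrarily), and obtain $p_{k+1}$ from $p_k$ by adding the midpoint of that sub-interval as a new partition point. Hausdorff distance of closed (here compact, nonempty) sets $A,B\subset\mathbb R^2$: $d_H(A,B)=\max\{\max_{a\in A}\min_{b\in B}d(a,b),\ \max_{b\in B}\min_{a\in A}d(a,b)\}$ with $d$ the Euclidean distance. *)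

theory Defs
  imports "HOL-Analysis.Analysis"
begin

text \<open>
  A partition \<open>(x\<^sub>0,\<dots>,x\<^sub>k)\<close> of \<open>[l,u]\<close> is the list of its points, so \<open>x\<^sub>i\<close> is \<open>xs ! i\<close>, \<open>k\<close> is
  \<open>length xs - 1\<close>, and the sub-intervals are \<open>[xs ! (i - 1), xs ! i]\<close> for \<open>i \<in> {1..<length xs}\<close>.
  Throughout, \<open>f'\<close> stands for the derivative of \<open>f\<close> on \<open>[l,u]\<close> (one-sided at \<open>l\<close> and \<open>u\<close>).
\<close>

definition is_partition :: "real \<Rightarrow> real \<Rightarrow> real list \<Rightarrow> bool" where
  "is_partition l u xs \<longleftrightarrow> xs \<noteq> [] \<and> hd xs = l \<and> last xs = u \<and> sorted_wrt (<) xs"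

text \<open>
  The last conjunct makes the change of curvature genuine: a point near which \<open>f\<close> is affine, or a
  point joining a convex piece to an affine one, is not a break point.
\<close>

definition break_point :: "(real \<Rightarrow> real) \<Rightarrow> real \<Rightarrow> real \<Rightarrow> real \<Rightarrow> bool" where
  "break_point f l u x \<longleftrightarrow>
     (\<exists>e>0. l \<le> x - e \<and> x + e \<le> u \<and>
        (convex_on {x - e..x} f \<and> concave_on {x..x + e} f \<or>
         concave_on {x - e..x} f \<and> convex_on {x..x + e} f) \<and>
        (\<forall>d. 0 < d \<and> d \<le> e \<longrightarrow>
           \<not> convex_on {x - d..x + d} f \<and> \<not> concave_on {x - d..x + d} f))"

definition pre_base_partition ::
    "(real \<Rightarrow> real) \<Rightarrow> (real \<Rightarrow> real) \<Rightarrow> real \<Rightarrow> real \<Rightarrow> real list \<Rightarrow> bool" where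
  "pre_base_partition f f' l u xs \<longleftrightarrow>
     is_partition l u xs \<and>
     (\<forall>x. break_point f l u x \<longrightarrow> x \<in> set xs) \<and>
     (\<forall>i\<in>{1..<length xs}. f' (xs ! (i - 1)) \<noteq> f' (xs ! i))"

definition canonical_base_points ::
    "(real \<Rightarrow> real) \<Rightarrow> (real \<Rightarrow> real) \<Rightarrow> real \<Rightarrow> real \<Rightarrow> real set" where
  "canonical_base_points f f' l u =
     (let C = {x. break_point f l u x} \<union> {l, u}
      in C \<union> {midpoint a b | a b.
               a \<in> C \<and> b \<in> C \<and> a < b \<and> C \<inter> {a<..<b} = {} \<and> f' a = f' b})"

text \<open>
  Minimality alone need not determine the partition; the last conjunct selects the canonical one.
\<close>

definition base_partition ::
    "(real \<Rightarrow> real) \<Rightarrow> (real \<Rightarrow> real) \<Rightarrow> real \<Rightarrow> real \<Rightarrow> real list \<Rightarrow> bool" where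
  "base_partition f f' l u xs \<longleftrightarrow>
     pre_base_partition f f' l u xs \<and>
     (\<forall>ys. pre_base_partition f f' l u ys \<longrightarrow> card (set xs) \<le> card (set ys)) \<and>
     set xs = canonical_base_points f f' l u"

definition bisect :: "real list \<Rightarrow> nat \<Rightarrow> real list" where
  "bisect xs i = take i xs @ midpoint (xs ! (i - 1)) (xs ! i) # drop i xs"

definition subinterval_bound :: "(real \<Rightarrow> real) \<Rightarrow> real list \<Rightarrow> nat \<Rightarrow> real" where
  "subinterval_bound f' xs i =
     (xs ! i - xs ! (i - 1)) * \<bar>f' (xs ! (i - 1)) - f' (xs ! i)\<bar> / 4"

definition max_bound_step :: "(real \<Rightarrow> real) \<Rightarrow> real list \<Rightarrow> real list \<Rightarrow> bool" where
  "max_bound_step f' xs ys \<longleftrightarrow>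
     (\<exists>i\<in>{1..<length xs}.
        (\<forall>j\<in>{1..<length xs}. subinterval_bound f' xs j \<le> subinterval_bound f' xs i) \<and>
        ys = bisect xs i)"

definition graph_point :: "(real \<Rightarrow> real) \<Rightarrow> real \<Rightarrow> real \<times> real" where
  "graph_point f a = (a, f a)"

definition tangent_line :: "(real \<Rightarrow> real) \<Rightarrow> (real \<Rightarrow> real) \<Rightarrow> real \<Rightarrow> (real \<times> real) set" where
  "tangent_line f f' a = {(x, y). y = f a + f' a * (x - a)}"

text \<open>
  A relation rather than a function, since the point is arbitrary on the segment when the two
  tangents coincide.
\<close>

definition tangent_intersection ::
    "(real \<Rightarrow> real) \<Rightarrow> (real \<Rightarrow> real) \<Rightarrow> real \<Rightarrow> real \<Rightarrow> real \<times> real \<Rightarrow> bool" where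
  "tangent_intersection f f' a b w \<longleftrightarrow>
     w \<in> tangent_line f f' a \<inter> tangent_line f f' b \<and>
     (tangent_line f f' a = tangent_line f f' b \<longrightarrow>
        w \<in> closed_segment (graph_point f a) (graph_point f b))"

text \<open>
  In the formulation, \<open>w i\<close> is the tangent intersection \<open>v\<^bsub>i-1,i\<^esub>\<close>, and vectors indexed by a
  finite set \<open>I\<close> are the extensional functions on \<open>I\<close>; their ranges carry the bounds on \<open>\<delta>\<close>
  and the integrality of \<open>z\<close>.
\<close>

definition milp_formulation ::
    "(real \<Rightarrow> real) \<Rightarrow> real list \<Rightarrow> (nat \<Rightarrow> real \<times> real) \<Rightarrow>
     (real \<times> real \<times> (nat \<Rightarrow> real) \<times> (nat \<Rightarrow> real) \<times> (nat \<Rightarrow> real)) set" where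
  "milp_formulation f xs w =
     (let k = length xs - 1; v = (\<lambda>i. graph_point f (xs ! i)) in
      {(x, y, \<delta>1, \<delta>2, z).
         y = snd (v 0) + (\<Sum>i=1..k. \<delta>1 i * (snd (w i) - snd (v (i - 1))) +
                                     \<delta>2 i * (snd (v i) - snd (v (i - 1)))) \<and>
         x = fst (v 0) + (\<Sum>i=1..k. \<delta>1 i * (fst (w i) - fst (v (i - 1))) +
                                     \<delta>2 i * (fst (v i) - fst (v (i - 1)))) \<and>
         \<delta>1 1 + \<delta>2 1 \<le> 1 \<and>
         (\<forall>i\<in>{2..k}. \<delta>1 i + \<delta>2 i \<le> z (i - 1) \<and> z (i - 1) \<le> \<delta>2 (i - 1)) \<and>
         \<delta>1 \<in> {1..k} \<rightarrow>\<^sub>E {0..1} \<and> \<delta>2 \<in> {1..k} \<rightarrow>\<^sub>E {0..1} \<and>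
         z \<in> {1..k - 1} \<rightarrow>\<^sub>E {0, 1}})"

definition proj_xy :: "(real \<times> real \<times> 'a) set \<Rightarrow> (real \<times> real) set" where
  "proj_xy R = (\<lambda>(x, y, r). (x, y)) ` R"

text \<open>
  Meaningful for nonempty bounded sets; on nonempty compact sets the suprema and infima are attained.
  On \<open>real \<times> real\<close>, \<open>dist\<close> is the Euclidean distance.
\<close>

definition hausdorff_distance :: "'a::metric_space set \<Rightarrow> 'a set \<Rightarrow> real" where
  "hausdorff_distance A B =
     max (SUP a\<in>A. INF b\<in>B. dist a b) (SUP b\<in>B. INF a\<in>A. dist a b)"

end

theory Submission
  imports Defs
begin

text \<open>
  The projected formulation is a union of triangles, one per sub-interval \<open>[a,b]\<close>, each spanned by
  a chord of the graph and the two tangents at its ends. On \<open>[a,b]\<close> the function is convex or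
  concave, so \<open>f'\<close> is monotone there, and by the mean value theorem both the graph and the
  triangle stay within vertical distance \<open>(b - a) * \<bar>f' a - f' b\<bar>\<close> of the tangent at \<open>a\<close>.
  Every triangle lies over its sub-interval and contains the chord, and the sub-intervals cover
  \<open>[l,u]\<close>; hence the Hausdorff distance to the graph is at most a constant times the maximal
  bound, and it is enough that the maximal bound tends to zero.

  Bisection never increases the maximal bound, because \<open>f'\<close> is monotone on the bisected
  sub-interval: each half has half the width and no larger jump of \<open>f'\<close>. It remains to see
  that the maximal bound gets below any \<open>\<epsilon> > 0\<close>. Otherwise every bisected sub-interval
  has bound at least \<open>\<epsilon>\<close>, and the jumps of \<open>f'\<close> never exceed the largest jump
  \<open>D\<close> of the initial partition, so only sub-intervals of width at least \<open>4 * \<epsilon> / D\<close> are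
  ever bisected. No sub-interval then becomes shorter than some fixed \<open>c > 0\<close>, which contradicts
  the number of sub-intervals growing without bound while their total width stays \<open>u - l\<close>.

  Three lemmas carry the argument: \<open>tangent_triangle_near_graph\<close> (geometry of one triangle),
  \<open>proj_milp_formulation\<close> (the projection is the union of the triangles) and
  \<open>max_bound_eventually_less\<close> (the counting argument).
\<close>

section \<open>Monotone derivatives\<close>

text \<open>
  For \<open>x < y\<close> the slope of the chord over \<open>[x,y]\<close> separates \<open>f' x\<close> from \<open>f' y\<close>: the
  slopes over \<open>[x,t]\<close> are at most that slope and tend to \<open>f' x\<close> as \<open>t\<close> decreases to \<open>x\<close>, and
  symmetrically at \<open>y\<close>. One-sided limits are what makes this work at the ends of the interval too.
\<close>

lemma convex_on_imp_mono_derivative: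
  fixes f f' :: "real \<Rightarrow> real"
  assumes conv: "convex_on {a..b} f"
    and der: "\<And>x. x \<in> {a..b} \<Longrightarrow> (f has_real_derivative f' x) (at x within {a..b})"
  shows "mono_on {a..b} f'"
proof (rule mono_onI)
  fix x y assume xy: "x \<in> {a..b}" "y \<in> {a..b}" "x \<le> y"
  show "f' x \<le> f' y"
  proof (cases "x = y")
    case False
    then have "x < y" using xy by simp
    let ?s = "(f x - f y) / (x - y)"
    have slopes: "(f x - f t) / (x - t) \<le> ?s" "?s \<le> (f t - f y) / (t - y)"
      if "t \<in> {x<..<y}" for t
      using convex_on_slope_le[OF conv xy(1,2)] that by auto
    have sub: "{x..y} \<subseteq> {a..b}" using xy by auto
    have "(f has_real_derivative f' x) (at_right x)"
      using DERIV_subset[OF der[OF xy(1)] sub] \<open>x < y\<close> by (simp add: at_within_Icc_at_right)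
    then have "((\<lambda>t. (f t - f x) / (t - x)) \<longlongrightarrow> f' x) (at_right x)"
      by (simp add: has_field_derivative_iff)
    moreover have "\<forall>\<^sub>F t in at_right x. (f t - f x) / (t - x) \<le> ?s"
      using eventually_at_right_real[OF \<open>x < y\<close>]
    proof eventually_elim
      case (elim t)
      then show ?case using slopes(1)[of t] minus_divide_divide[of "f x - f t" "x - t"] by simp
    qed
    ultimately have "f' x \<le> ?s" by (intro tendsto_upperbound) auto
    have "(f has_real_derivative f' y) (at_left y)"
      using DERIV_subset[OF der[OF xy(2)] sub] \<open>x < y\<close> by (simp add: at_within_Icc_at_left)
    then have "((\<lambda>t. (f t - f y) / (t - y)) \<longlongrightarrow> f' y) (at_left y)"
      by (simp add: has_field_derivative_iff)
    moreover have "\<forall>\<^sub>F t in at_left y. ?s \<le> (f t - f y) / (t - y)"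
      using eventually_at_left_real[OF \<open>x < y\<close>] by eventually_elim (use slopes(2) in auto)
    ultimately have "?s \<le> f' y" by (intro tendsto_lowerbound) auto
    with \<open>f' x \<le> ?s\<close> show ?thesis by simp
  qed simp
qed

lemma concave_on_imp_antimono_derivative:
  fixes f f' :: "real \<Rightarrow> real"
  assumes conc: "concave_on {a..b} f"
    and der: "\<And>x. x \<in> {a..b} \<Longrightarrow> (f has_real_derivative f' x) (at x within {a..b})"
  shows "antimono_on {a..b} f'"
proof -
  have "mono_on {a..b} (\<lambda>x. - f' x)"
  proof (rule convex_on_imp_mono_derivative)
    show "convex_on {a..b} (\<lambda>x. - f x)" using conc by (simp add: concave_on_def)
  qed (auto intro!: derivative_intros der)
  then show ?thesis by (auto simp: monotone_on_def)
qed

text \<open>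
  The direction of monotonicity is left open so that convex and concave pieces are treated alike;
  all later estimates involve only \<open>\<bar>g a - g b\<bar>\<close>.
\<close>

definition monotone_between :: "(real \<Rightarrow> real) \<Rightarrow> real \<Rightarrow> real \<Rightarrow> bool" where
  "monotone_between g a b \<longleftrightarrow> mono_on {a..b} g \<or> antimono_on {a..b} g"

lemma monotone_between_subinterval:
  assumes "monotone_between g a b" "a \<le> c" "d \<le> b"
  shows "monotone_between g c d"
  using assms monotone_on_subset[of "{a..b}" _ _ g "{c..d}"]
  unfolding monotone_between_def by auto

lemma monotone_between_diff_le:
  assumes "monotone_between g a b" "x \<in> {a..b}" "y \<in> {a..b}"
  shows "\<bar>g x - g y\<bar> \<le> \<bar>g a - g b\<bar>"
proof -
  have ab: "a \<in> {a..b}" "b \<in> {a..b}" using assms by auto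
  have "g a \<le> g z \<and> g z \<le> g b" if "mono_on {a..b} g" "z \<in> {a..b}" for z
    using that ab by (auto simp: monotone_on_def)
  moreover have "g b \<le> g z \<and> g z \<le> g a" if "antimono_on {a..b} g" "z \<in> {a..b}" for z
    using that ab by (auto simp: monotone_on_def)
  ultimately show ?thesis
    using assms unfolding monotone_between_def by (smt (verit))
qed

section \<open>Distance from a tangent triangle to the graph\<close>

text \<open>
  By the mean value theorem the deviation at \<open>x\<close> is \<open>(x - a) * (f' z - f' a)\<close> for some \<open>z\<close>
  between \<open>a\<close> and \<open>x\<close>, and monotonicity bounds the second factor by the jump over \<open>[a,b]\<close>.
\<close>

lemma tangent_deviation:
  fixes f f' :: "real \<Rightarrow> real"
  assumes der: "\<And>x. x \<in> {a..b} \<Longrightarrow> (f has_real_derivative f' x) (at x within {a..b})"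
    and mono: "monotone_between f' a b" and x: "x \<in> {a..b}"
  shows "\<bar>f x - (f a + f' a * (x - a))\<bar> \<le> (b - a) * \<bar>f' a - f' b\<bar>"
proof (cases "x = a")
  case False
  then have "a < x" using x by simp
  have "\<exists>z\<in>{a<..<x}. f x - f a = f' z * (x - a)"
  proof (rule mvt_simple[OF \<open>a < x\<close>])
    fix y assume "a \<le> y" "y \<le> x"
    then show "(f has_derivative (*) (f' y)) (at y within {a..x})"
      using DERIV_subset[OF der[of y], of "{a..x}"] x by (auto simp: has_field_derivative_def)
  qed
  then obtain z where z: "z \<in> {a<..<x}" "f x - f a = f' z * (x - a)" by blast
  have dev: "f x - (f a + f' a * (x - a)) = (x - a) * (f' z - f' a)"
    using z(2) by (simp add: algebra_simps)
  have "\<bar>f x - (f a + f' a * (x - a))\<bar> = (x - a) * \<bar>f' z - f' a\<bar>"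
    using arg_cong[OF dev, of abs] \<open>a < x\<close> by (simp add: abs_mult)
  also have "\<dots> \<le> (b - a) * \<bar>f' a - f' b\<bar>"
    using x z(1) \<open>a < x\<close> monotone_between_diff_le[OF mono, of z a] by (intro mult_mono) auto
  finally show ?thesis .
qed (use x in simp)

text \<open>
  The slope of the chord is \<open>f' z\<close> for some \<open>z\<close> inside the interval, hence lies between \<open>f' a\<close>
  and \<open>f' b\<close>. Solving for the intersection of the two tangents divides \<open>[a,b]\<close> in the
  nonnegative ratio of \<open>f' b - f' z\<close> to \<open>f' z - f' a\<close>. If \<open>f' a = f' b\<close>, all three slopes agree,
  so the tangents coincide and the apex is on the chord by definition.
\<close>

lemma tangent_intersection_abscissa:
  fixes f f' :: "real \<Rightarrow> real"
  assumes "a < b"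
    and der: "\<And>x. x \<in> {a..b} \<Longrightarrow> (f has_real_derivative f' x) (at x within {a..b})"
    and mono: "monotone_between f' a b"
    and w: "tangent_intersection f f' a b w"
  shows "fst w \<in> {a..b}"
proof -
  have "\<exists>z\<in>{a<..<b}. f b - f a = f' z * (b - a)"
    using der by (intro mvt_simple[OF \<open>a < b\<close>]) (auto simp: has_field_derivative_def)
  then obtain z where z: "z \<in> {a<..<b}" "f b - f a = f' z * (b - a)" by blast
  have between: "f' a \<le> f' z \<and> f' z \<le> f' b \<or> f' b \<le> f' z \<and> f' z \<le> f' a"
    using mono z(1) unfolding monotone_between_def monotone_on_def by auto
  have on_tangents: "snd w = f a + f' a * (fst w - a)" "snd w = f b + f' b * (fst w - b)"
    using w by (auto simp: tangent_intersection_def tangent_line_def)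
  show ?thesis
  proof (cases "f' a = f' b")
    case True
    then have "f' z = f' a" using between by auto
    then have "f b + f' b * (x - b) = f a + f' a * (x - a)" for x
      using z(2) True by (simp add: algebra_simps)
    then have "tangent_line f f' a = tangent_line f f' b" by (simp add: tangent_line_def)
    then have "w \<in> closed_segment (graph_point f a) (graph_point f b)"
      using w by (simp add: tangent_intersection_def)
    then have "fst w \<in> closed_segment a b"
      by (auto simp: closed_segment_def graph_point_def)
    then show ?thesis using \<open>a < b\<close> by (simp add: closed_segment_eq_real_ivl)
  next
    case False
    have left: "(f' b - f' a) * (fst w - a) = (f' b - f' z) * (b - a)"
      and right: "(f' b - f' a) * (b - fst w) = (f' z - f' a) * (b - a)"
      using on_tangents z(2) by (auto simp: algebra_simps)
    show ?thesis
    proof (cases "f' a < f' b")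
      case True
      then have "0 \<le> (f' b - f' a) * (fst w - a)" "0 \<le> (f' b - f' a) * (b - fst w)"
        unfolding left right using between \<open>a < b\<close> by auto
      then show ?thesis using True by (simp add: zero_le_mult_iff)
    next
      case False
      with \<open>f' a \<noteq> f' b\<close> have lt: "f' b < f' a" by simp
      have "(f' b - f' a) * (fst w - a) \<le> 0" "(f' b - f' a) * (b - fst w) \<le> 0"
        unfolding left right using between \<open>a < b\<close> lt by (auto simp: mult_le_0_iff)
      then show ?thesis using lt by (simp add: mult_le_0_iff)
    qed
  qed
qed

text \<open>
  The points over \<open>[a,b]\<close> within vertical distance \<open>K = (b - a) * \<bar>f' a - f' b\<bar>\<close> of the tangent
  at \<open>a\<close> form a convex strip. It contains the three vertices, hence the triangle, and it contains
  the graph; the triangle inequality gives the factor 2.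
\<close>

lemma tangent_triangle_near_graph:
  fixes f f' :: "real \<Rightarrow> real"
  assumes "a < b"
    and der: "\<And>x. x \<in> {a..b} \<Longrightarrow> (f has_real_derivative f' x) (at x within {a..b})"
    and mono: "monotone_between f' a b"
    and w: "tangent_intersection f f' a b w"
    and q: "q \<in> convex hull {graph_point f a, w, graph_point f b}"
  shows "fst q \<in> {a..b}" "\<bar>snd q - f (fst q)\<bar> \<le> 2 * ((b - a) * \<bar>f' a - f' b\<bar>)"
proof -
  define K where "K = (b - a) * \<bar>f' a - f' b\<bar>"
  define c where "c = f a - f' a * a"
  \<comment> \<open>The linear map \<open>?L\<close> shears the strip into a rectangle, which makes its convexity evident.\<close>
  let ?L = "\<lambda>q :: real \<times> real. (fst q, snd q - f' a * fst q)"
  let ?T = "?L -` ({a..b} \<times> {c - K..c + K})"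
  have "K \<ge> 0" using \<open>a < b\<close> by (simp add: K_def)
  have dev: "\<bar>f x - (c + f' a * x)\<bar> \<le> K" if "x \<in> {a..b}" for x
    using tangent_deviation[OF der mono that] by (simp add: K_def c_def algebra_simps)
  have "linear ?L" by (intro linearI) (auto simp: algebra_simps)
  then have "convex ?T" by (intro convex_linear_vimage convex_Times) auto
  moreover have "graph_point f a \<in> ?T" "graph_point f b \<in> ?T"
    using dev[of a] dev[of b] \<open>a < b\<close> by (auto simp: graph_point_def)
  moreover have "snd w = c + f' a * fst w"
    using w by (auto simp: tangent_intersection_def tangent_line_def c_def algebra_simps)
  then have "w \<in> ?T"
    using tangent_intersection_abscissa[OF \<open>a < b\<close> der mono w] \<open>K \<ge> 0\<close> by simp
  ultimately have "convex hull {graph_point f a, w, graph_point f b} \<subseteq> ?T"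
    by (intro hull_minimal) auto
  with q have "q \<in> ?T" by blast
  then show *: "fst q \<in> {a..b}" by simp
  show "\<bar>snd q - f (fst q)\<bar> \<le> 2 * ((b - a) * \<bar>f' a - f' b\<bar>)"
    using \<open>q \<in> ?T\<close> dev[OF *] unfolding K_def[symmetric] by auto
qed

section \<open>The projected formulation is a union of triangles\<close>

text \<open>
  A path that makes the full steps of \<open>v\<close> before index \<open>j\<close>, a last step \<open>e\<close> at \<open>j\<close>, and then
  stops, ends at \<open>v (j - 1) + e\<close>.
\<close>

lemma sum_path:
  fixes v :: "nat \<Rightarrow> 'a::ab_group_add"
  assumes "j \<in> {1..k}"
  shows "(\<Sum>i=1..k. if i < j then v i - v (i - 1) else if i = j then e else 0)
           = v (j - 1) - v 0 + e"
proof -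
  let ?g = "\<lambda>i. if i < j then v i - v (i - 1) else if i = j then e else 0"
  have "sum ?g {1..k} = sum ?g {1..j}"
    using assms by (intro sum.mono_neutral_right) auto
  also have "{1..j} = insert j {1..j - 1}" using assms by auto
  also have "sum ?g \<dots> = e + sum ?g {1..j - 1}" using assms by (subst sum.insert) auto
  also have "sum ?g {1..j - 1} = (\<Sum>i=Suc 0..j - 1. v i - v (i - 1))"
    using assms by (intro sum.cong) auto
  also have "\<dots> = v (j - 1) - v 0" by (rule sum_telescope'') simp
  finally show ?thesis by simp
qed

text \<open>
  The constraints force the segments to be filled one after the other. A binary \<open>z i = 1\<close>
  forces \<open>\<delta>2 i = 1\<close>, hence \<open>\<delta>1 i = 0\<close>; a binary \<open>z i = 0\<close> forces everything after
  \<open>i\<close> to vanish. So the first \<open>j\<close> with \<open>z j = 0\<close> (or \<open>j = k\<close> if there is none) is the only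
  segment that can be partly filled.
\<close>

lemma filling_pattern:
  fixes \<delta>1 \<delta>2 z :: "nat \<Rightarrow> real"
  assumes "k \<ge> 1" and first: "\<delta>1 1 + \<delta>2 1 \<le> 1"
    and chain: "\<And>i. i \<in> {2..k} \<Longrightarrow> \<delta>1 i + \<delta>2 i \<le> z (i - 1) \<and> z (i - 1) \<le> \<delta>2 (i - 1)"
    and range: "\<And>i. i \<in> {1..k} \<Longrightarrow> \<delta>1 i \<in> {0..1} \<and> \<delta>2 i \<in> {0..1}"
    and binary: "\<And>i. i \<in> {1..k - 1} \<Longrightarrow> z i \<in> {0, 1}"
  obtains j where "j \<in> {1..k}" "\<delta>1 j + \<delta>2 j \<le> 1"
    "\<And>i. i \<in> {1..<j} \<Longrightarrow> \<delta>1 i = 0 \<and> \<delta>2 i = 1"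
    "\<And>i. i \<in> {j<..k} \<Longrightarrow> \<delta>1 i = 0 \<and> \<delta>2 i = 0"
proof -
  define j where "j = (LEAST i. i \<ge> 1 \<and> (i = k \<or> z i = 0))"
  have "j \<ge> 1 \<and> (j = k \<or> z j = 0)" unfolding j_def by (rule LeastI[of _ k]) (use \<open>k \<ge> 1\<close> in simp)
  moreover have "j \<le> k" unfolding j_def by (rule Least_le) (use \<open>k \<ge> 1\<close> in simp)
  ultimately have j: "j \<in> {1..k}" "j = k \<or> z j = 0" by auto
  have full: "z i = 1" if "i \<in> {1..<j}" for i
  proof -
    have "\<not> (i \<ge> 1 \<and> (i = k \<or> z i = 0))" using that not_less_Least[of i] unfolding j_def by auto
    then show ?thesis using that j binary[of i] by auto
  qed
  have sum_le: "\<delta>1 i + \<delta>2 i \<le> 1" if "i \<in> {1..j}" for i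
  proof (cases "i = 1")
    case False
    then have "i - 1 \<in> {1..<j}" "i \<in> {2..k}" using that j by auto
    then show ?thesis using chain[of i] full[of "i - 1"] by simp
  qed (use first in simp)
  have before: "\<delta>1 i = 0 \<and> \<delta>2 i = 1" if "i \<in> {1..<j}" for i
    using chain[of "Suc i"] full[OF that] range[of i] sum_le[of i] that j by auto
  have after: "\<delta>1 (Suc i) = 0 \<and> \<delta>2 (Suc i) = 0" if "j \<le> i" "i < k" for i
    using that
  proof (induction i rule: dec_induct)
    case base
    then show ?case using chain[of "Suc j"] range[of "Suc j"] j by auto
  next
    case (step i)
    then show ?case
      using chain[of "Suc (Suc i)"] range[of "Suc (Suc i)"] binary[of "Suc i"] j by auto
  qed
  show thesis
  proof
    show "\<delta>1 i = 0 \<and> \<delta>2 i = 0" if "i \<in> {j<..k}" for i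
      using after[of "i - 1"] that by auto
  qed (use j sum_le before in auto)
qed

text \<open>
  By \<open>filling_pattern\<close> the sum in the formulation is a walk along the graph points up to
  \<open>v (j - 1)\<close>, followed by a point of the \<open>j\<close>-th triangle in the coordinates \<open>\<delta>1 j, \<delta>2 j\<close>
  with respect to the edges at \<open>v (j - 1)\<close>. Conversely every such filling is feasible.
\<close>

lemma proj_milp_formulation:
  assumes "length xs \<ge> 2"
  shows "proj_xy (milp_formulation f xs w) =
    (\<Union>i\<in>{1..<length xs}. convex hull {graph_point f (xs ! (i - 1)), w i, graph_point f (xs ! i)})"
proof -
  define k where "k = length xs - 1"
  define v where "v i = graph_point f (xs ! i)" for i
  define inc where "inc \<delta>1 \<delta>2 i = \<delta>1 i *\<^sub>R (w i - v (i - 1)) + \<delta>2 i *\<^sub>R (v i - v (i - 1))"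
    for \<delta>1 \<delta>2 :: "nat \<Rightarrow> real" and i
  have k: "k \<ge> 1" "{1..<length xs} = {1..k}" using assms by (auto simp: k_def)
  have mem: "(x, y, \<delta>1, \<delta>2, z) \<in> milp_formulation f xs w \<longleftrightarrow>
       (x, y) = v 0 + (\<Sum>i=1..k. inc \<delta>1 \<delta>2 i) \<and> \<delta>1 1 + \<delta>2 1 \<le> 1 \<and>
       (\<forall>i\<in>{2..k}. \<delta>1 i + \<delta>2 i \<le> z (i - 1) \<and> z (i - 1) \<le> \<delta>2 (i - 1)) \<and>
       \<delta>1 \<in> {1..k} \<rightarrow>\<^sub>E {0..1} \<and> \<delta>2 \<in> {1..k} \<rightarrow>\<^sub>E {0..1} \<and> z \<in> {1..k - 1} \<rightarrow>\<^sub>E {0, 1}"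
    for x y \<delta>1 \<delta>2 z
    unfolding milp_formulation_def Let_def k_def[symmetric] v_def[symmetric]
    by (auto simp: prod_eq_iff fst_sum snd_sum inc_def)
  have pattern_sum: "(\<Sum>i=1..k. inc \<delta>1 \<delta>2 i) = v (j - 1) - v 0 + inc \<delta>1 \<delta>2 j"
    if "j \<in> {1..k}" "\<And>i. i \<in> {1..<j} \<Longrightarrow> \<delta>1 i = 0 \<and> \<delta>2 i = 1"
      "\<And>i. i \<in> {j<..k} \<Longrightarrow> \<delta>1 i = 0 \<and> \<delta>2 i = 0" for \<delta>1 \<delta>2 j
  proof -
    have "(\<Sum>i=1..k. inc \<delta>1 \<delta>2 i) =
        (\<Sum>i=1..k. if i < j then v i - v (i - 1) else if i = j then inc \<delta>1 \<delta>2 j else 0)"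
      by (intro sum.cong) (auto simp: that(2,3) inc_def)
    then show ?thesis using sum_path[OF that(1), of v "inc \<delta>1 \<delta>2 j"] by simp
  qed
  have "proj_xy (milp_formulation f xs w) = (\<Union>i\<in>{1..k}. convex hull {v (i - 1), w i, v i})"
  proof (intro equalityI subsetI)
    fix q assume "q \<in> proj_xy (milp_formulation f xs w)"
    then obtain \<delta>1 \<delta>2 z where m: "(fst q, snd q, \<delta>1, \<delta>2, z) \<in> milp_formulation f xs w"
      by (auto simp: proj_xy_def)
    from m have range: "\<delta>1 i \<in> {0..1} \<and> \<delta>2 i \<in> {0..1}" if "i \<in> {1..k}" for i
      using that unfolding mem by (meson PiE_mem)
    from m have binary: "z i \<in> {0, 1}" if "i \<in> {1..k - 1}" for i
      using that unfolding mem by (meson PiE_mem)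
    from m have first: "\<delta>1 1 + \<delta>2 1 \<le> 1" and
      chain: "\<And>i. i \<in> {2..k} \<Longrightarrow> \<delta>1 i + \<delta>2 i \<le> z (i - 1) \<and> z (i - 1) \<le> \<delta>2 (i - 1)"
      unfolding mem by blast+
    obtain j where j: "j \<in> {1..k}" "\<delta>1 j + \<delta>2 j \<le> 1"
      "\<And>i. i \<in> {1..<j} \<Longrightarrow> \<delta>1 i = 0 \<and> \<delta>2 i = 1"
      "\<And>i. i \<in> {j<..k} \<Longrightarrow> \<delta>1 i = 0 \<and> \<delta>2 i = 0"
      using filling_pattern[OF k(1) first chain range binary] by blast
    have "q = v (j - 1) + inc \<delta>1 \<delta>2 j"
      using m pattern_sum[OF j(1,3,4)] by (simp add: mem)
    then have "q \<in> convex hull {v (j - 1), w j, v j}"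
      using range[OF j(1)] j(2) unfolding convex_hull_3_alt inc_def by (auto simp: add.assoc)
    then show "q \<in> (\<Union>i\<in>{1..k}. convex hull {v (i - 1), w i, v i})" using j(1) by blast
  next
    fix q assume "q \<in> (\<Union>i\<in>{1..k}. convex hull {v (i - 1), w i, v i})"
    then obtain j s t where j: "j \<in> {1..k}" and st: "0 \<le> s" "0 \<le> t" "s + t \<le> 1"
      and q: "q = v (j - 1) + s *\<^sub>R (w j - v (j - 1)) + t *\<^sub>R (v j - v (j - 1))"
      unfolding convex_hull_3_alt by blast
    define \<delta>1 where "\<delta>1 = (\<lambda>i\<in>{1..k}. if i = j then s else 0)"
    define \<delta>2 where "\<delta>2 = (\<lambda>i\<in>{1..k}. if i < j then 1 else if i = j then t else 0)"
    define z :: "nat \<Rightarrow> real" where "z = (\<lambda>i\<in>{1..k - 1}. if i < j then 1 else 0)"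
    have "inc \<delta>1 \<delta>2 j = s *\<^sub>R (w j - v (j - 1)) + t *\<^sub>R (v j - v (j - 1))"
      using j by (simp add: inc_def \<delta>1_def \<delta>2_def)
    then have "q = v 0 + (\<Sum>i=1..k. inc \<delta>1 \<delta>2 i)"
      using j by (subst pattern_sum[of j]) (auto simp: q \<delta>1_def \<delta>2_def)
    moreover have "\<delta>1 1 + \<delta>2 1 \<le> 1"
      using j st by (auto simp: \<delta>1_def \<delta>2_def)
    moreover have "\<delta>1 i + \<delta>2 i \<le> z (i - 1) \<and> z (i - 1) \<le> \<delta>2 (i - 1)" if "i \<in> {2..k}" for i
      using that j st by (auto simp: \<delta>1_def \<delta>2_def z_def)
    moreover have "\<delta>1 \<in> {1..k} \<rightarrow>\<^sub>E {0..1}" "\<delta>2 \<in> {1..k} \<rightarrow>\<^sub>E {0..1}" "z \<in> {1..k - 1} \<rightarrow>\<^sub>E {0, 1}"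
      using st by (auto simp: \<delta>1_def \<delta>2_def z_def)
    ultimately have "(fst q, snd q, \<delta>1, \<delta>2, z) \<in> milp_formulation f xs w"
      unfolding mem prod.collapse by blast
    then show "q \<in> proj_xy (milp_formulation f xs w)"
      unfolding proj_xy_def by (force simp: image_iff)
  qed
  then show ?thesis unfolding k(2) v_def .
qed

section \<open>Bisection of partitions\<close>

text \<open>
  Stating invariants as relations between neighbouring points lets each of them pass to a bisected
  partition by checking only the two halves of the bisected sub-interval.
\<close>

definition on_subintervals :: "(real \<Rightarrow> real \<Rightarrow> bool) \<Rightarrow> real list \<Rightarrow> bool" where
  "on_subintervals P xs \<longleftrightarrow> (\<forall>i\<in>{1..<length xs}. P (xs ! (i - 1)) (xs ! i))"

lemma on_subintervalsD:
  "on_subintervals P xs \<Longrightarrow> i \<in> {1..<length xs} \<Longrightarrow> P (xs ! (i - 1)) (xs ! i)"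
  by (simp add: on_subintervals_def)

lemma is_partition_iff_on_subintervals:
  "is_partition l u xs \<longleftrightarrow> xs \<noteq> [] \<and> hd xs = l \<and> last xs = u \<and> on_subintervals (<) xs"
proof -
  have "on_subintervals (<) xs \<longleftrightarrow> (\<forall>i. Suc i < length xs \<longrightarrow> xs ! i < xs ! Suc i)"
    unfolding on_subintervals_def
  proof (intro iffI allI impI ballI)
    fix i assume "\<forall>i\<in>{1..<length xs}. xs ! (i - 1) < xs ! i" "Suc i < length xs"
    then show "xs ! i < xs ! Suc i" by (auto dest: bspec[of _ _ "Suc i"])
  next
    fix i assume "\<forall>i. Suc i < length xs \<longrightarrow> xs ! i < xs ! Suc i" "i \<in> {1..<length xs}"
    then show "xs ! (i - 1) < xs ! i" by (auto dest: spec[of _ "i - 1"])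
  qed
  then show ?thesis by (simp add: is_partition_def sorted_wrt_iff_nth_Suc_transp)
qed

lemma length_bisect: "length (bisect xs i) = Suc (length xs)"
  by (auto simp: bisect_def)

lemma on_subintervals_bisect:
  assumes i: "i \<in> {1..<length xs}" and P: "on_subintervals P xs"
    and left: "P (xs ! (i - 1)) (midpoint (xs ! (i - 1)) (xs ! i))"
    and right: "P (midpoint (xs ! (i - 1)) (xs ! i)) (xs ! i)"
  shows "on_subintervals P (bisect xs i)"
  unfolding on_subintervals_def
proof
  fix j assume j: "j \<in> {1..<length (bisect xs i)}"
  have nth: "bisect xs i ! n = (if n < i then xs ! n
      else if n = i then midpoint (xs ! (i - 1)) (xs ! i) else xs ! (n - 1))"
    if "n \<le> length xs" for n
    using that i by (auto simp: bisect_def nth_append nth_Cons')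
  consider "j < i" | "j = i" | "j = Suc i" | "Suc i < j" by linarith
  then show "P (bisect xs i ! (j - 1)) (bisect xs i ! j)"
  proof cases
    case 4
    then show ?thesis using on_subintervalsD[OF P, of "j - 1"] j by (auto simp: nth length_bisect)
  qed (use i j left right on_subintervalsD[OF P, of j] in \<open>auto simp: nth length_bisect\<close>)
qed

lemma is_partition_bisect:
  assumes "is_partition l u xs" "i \<in> {1..<length xs}"
  shows "is_partition l u (bisect xs i)"
proof -
  have xs: "xs \<noteq> []" "hd xs = l" "last xs = u" "on_subintervals (<) xs"
    using assms(1) by (auto simp: is_partition_iff_on_subintervals)
  have "on_subintervals (<) (bisect xs i)"
    using on_subintervalsD[OF xs(4) assms(2)]
    by (intro on_subintervals_bisect assms(2) xs(4)) (auto simp: midpoint_def)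
  moreover have "hd (bisect xs i) = l" "last (bisect xs i) = u"
    using assms(2) xs by (auto simp: bisect_def hd_append)
  ultimately show ?thesis by (simp add: is_partition_iff_on_subintervals bisect_def)
qed

lemma is_partition_length_ge_2:
  assumes "is_partition l u xs" "l < u"
  shows "length xs \<ge> 2"
proof (rule ccontr)
  assume "\<not> length xs \<ge> 2"
  moreover have "length xs \<noteq> 0" using assms(1) by (simp add: is_partition_def)
  ultimately have "length xs = 1" by linarith
  with assms show False by (auto simp: is_partition_def length_Suc_conv)
qed

lemma is_partition_covers:
  assumes "is_partition l u xs" "l < u" "x \<in> {l..u}"
  obtains i where "i \<in> {1..<length xs}" "x \<in> {xs ! (i - 1)..xs ! i}"
proof -
  have xs: "xs ! 0 = l" "xs ! (length xs - 1) = u"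
    using assms(1) by (auto simp: is_partition_def hd_conv_nth last_conv_nth)
  have len: "length xs \<ge> 2" by (rule is_partition_length_ge_2[OF assms(1,2)])
  define i where "i = (LEAST i. 1 \<le> i \<and> x \<le> xs ! i)"
  have wit: "1 \<le> length xs - 1 \<and> x \<le> xs ! (length xs - 1)" using len assms(3) xs by auto
  have i: "1 \<le> i \<and> x \<le> xs ! i" unfolding i_def by (rule LeastI_ex) (use wit in blast)
  have "i \<le> length xs - 1" unfolding i_def by (rule Least_le) (rule wit)
  moreover have "xs ! (i - 1) \<le> x"
  proof (cases "i = 1")
    case False
    with i have "i - 1 < i" "1 \<le> i - 1" by auto
    then have "\<not> x \<le> xs ! (i - 1)"
      using not_less_Least[of "i - 1" "\<lambda>i. 1 \<le> i \<and> x \<le> xs ! i"] unfolding i_def by blast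
    then show ?thesis by simp
  qed (use xs assms(3) in auto)
  ultimately show thesis using i len that[of i] by auto
qed

lemma is_partition_width_sum:
  assumes "is_partition l u xs"
  shows "(\<Sum>i\<in>{1..<length xs}. xs ! i - xs ! (i - 1)) = u - l"
proof -
  have xs: "xs \<noteq> []" "xs ! 0 = l" "xs ! (length xs - 1) = u"
    using assms by (auto simp: is_partition_def hd_conv_nth last_conv_nth)
  have "{1..<length xs} = {Suc 0..length xs - 1}" using xs(1) by (cases xs) auto
  then show ?thesis using xs sum_telescope''[of 0 "length xs - 1" "\<lambda>i. xs ! i"] by simp
qed

lemma is_partition_subinterval:
  assumes "is_partition l u xs" "i \<in> {1..<length xs}"
  shows "l \<le> xs ! (i - 1)" "xs ! (i - 1) < xs ! i" "xs ! i \<le> u"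
proof -
  have xs: "xs ! 0 = l" "xs ! (length xs - 1) = u" and s: "sorted_wrt (<) xs"
    using assms(1) by (auto simp: is_partition_def hd_conv_nth last_conv_nth)
  have le: "xs ! m \<le> xs ! n" if "m \<le> n" "n < length xs" for m n
    using sorted_wrt_nth_less[OF s, of m n] that by (cases "m = n") auto
  show "l \<le> xs ! (i - 1)" using le[of 0 "i - 1"] xs assms(2) by auto
  show "xs ! i \<le> u" using le[of i "length xs - 1"] xs assms(2) by auto
  show "xs ! (i - 1) < xs ! i" using sorted_wrt_nth_less[OF s, of "i - 1" i] assms(2) by auto
qed

section \<open>The maximal bound tends to zero\<close>

lemma max_bound_procedure_invariant:
  assumes step: "\<And>k. max_bound_step f' (p k) (p (Suc k))"
    and init: "is_partition l u (p 0)" "on_subintervals (monotone_between f') (p 0)"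
  shows "is_partition l u (p k) \<and> on_subintervals (monotone_between f') (p k)"
proof (induction k)
  case (Suc k)
  obtain i where i: "i \<in> {1..<length (p k)}" and eq: "p (Suc k) = bisect (p k) i"
    using step[of k] unfolding max_bound_step_def by blast
  have "p k ! (i - 1) < p k ! i" using is_partition_subinterval(2) Suc i by blast
  moreover have "monotone_between f' (p k ! (i - 1)) (p k ! i)"
    using Suc i by (blast intro: on_subintervalsD)
  ultimately have "on_subintervals (monotone_between f') (p (Suc k))"
    unfolding eq using Suc i
    by (intro on_subintervals_bisect) (auto intro: monotone_between_subinterval simp: midpoint_def)
  with Suc i eq show ?case by (simp add: is_partition_bisect)
qed (use init in simp)

lemma on_subintervals_uniform_bound:
  fixes F :: "real \<Rightarrow> real \<Rightarrow> real"
  obtains D where "D > 0" "on_subintervals (\<lambda>a b. F a b \<le> D) xs"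
proof
  define D where "D = 1 + (\<Sum>i\<in>{1..<length xs}. \<bar>F (xs ! (i - 1)) (xs ! i)\<bar>)"
  show "D > 0" unfolding D_def by (intro add_pos_nonneg sum_nonneg) auto
  have "\<bar>F (xs ! (i - 1)) (xs ! i)\<bar> \<le> D - 1" if "i \<in> {1..<length xs}" for i
    unfolding D_def using member_le_sum[OF that, of "\<lambda>i. \<bar>F (xs ! (i - 1)) (xs ! i)\<bar>"] by simp
  then show "on_subintervals (\<lambda>a b. F a b \<le> D) xs"
    unfolding on_subintervals_def by force
qed

text \<open>
  If the maximal bound were always at least \<open>\<epsilon>\<close>, only wide sub-intervals would ever be
  bisected, so all widths would stay above a fixed \<open>c > 0\<close>; but \<open>k\<close> sub-intervals of width at
  least \<open>c\<close> do not fit into \<open>[l,u]\<close> for large \<open>k\<close>. Once all bounds are below \<open>\<epsilon>\<close> they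
  remain so, since halving a sub-interval does not increase its bound.
\<close>

lemma max_bound_eventually_less:
  assumes step: "\<And>k. max_bound_step f' (p k) (p (Suc k))"
    and init: "is_partition l u (p 0)" "on_subintervals (monotone_between f') (p 0)"
    and "\<epsilon> > 0"
  shows "\<forall>\<^sub>F k in sequentially. \<forall>i\<in>{1..<length (p k)}. subinterval_bound f' (p k) i < \<epsilon>"
proof -
  define \<beta> where "\<beta> a b = (b - a) * \<bar>f' a - f' b\<bar> / 4" for a b
  define small where "small k \<longleftrightarrow> on_subintervals (\<lambda>a b. \<beta> a b < \<epsilon>) (p k)" for k
  note inv = max_bound_procedure_invariant[OF step init]
  obtain i where i: "\<And>k. i k \<in> {1..<length (p k)}"
    and maximal: "\<And>k j. j \<in> {1..<length (p k)} \<Longrightarrow>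
          subinterval_bound f' (p k) j \<le> subinterval_bound f' (p k) (i k)"
    and eq: "\<And>k. p (Suc k) = bisect (p k) (i k)"
    using step unfolding max_bound_step_def by metis
  define a where "a k = p k ! (i k - 1)" for k
  define b where "b k = p k ! i k" for k
  have ab: "a k < b k" for k
    unfolding a_def b_def using is_partition_subinterval(2) inv i by blast
  have mono: "monotone_between f' (a k) (b k)" for k
    unfolding a_def b_def using inv i by (blast intro: on_subintervalsD)
  have bisect: "on_subintervals P (p (Suc k))"
    if "on_subintervals P (p k)" "P (a k) (midpoint (a k) (b k))" "P (midpoint (a k) (b k)) (b k)"
    for P k
    unfolding eq using that i unfolding a_def b_def by (intro on_subintervals_bisect) auto
  have m: "midpoint (a k) (b k) - a k = (b k - a k) / 2" "b k - midpoint (a k) (b k) = (b k - a k) / 2"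
    "midpoint (a k) (b k) \<in> {a k..b k}" for k
    using ab[of k] by (auto simp: midpoint_def field_simps)
  have jump: "\<bar>f' (a k) - f' (midpoint (a k) (b k))\<bar> \<le> \<bar>f' (a k) - f' (b k)\<bar>"
    "\<bar>f' (midpoint (a k) (b k)) - f' (b k)\<bar> \<le> \<bar>f' (a k) - f' (b k)\<bar>" for k
    using monotone_between_diff_le[OF mono] m(3) ab[of k] by auto
  have halves: "\<beta> (a k) (midpoint (a k) (b k)) \<le> \<beta> (a k) (b k)"
    "\<beta> (midpoint (a k) (b k)) (b k) \<le> \<beta> (a k) (b k)" for k
    unfolding \<beta>_def m using jump[of k] ab[of k] by (intro divide_right_mono mult_mono; simp)+
  have small_Suc: "small (Suc k)" if "small k" for k
  proof -
    have "\<beta> (a k) (b k) < \<epsilon>" using that i unfolding small_def a_def b_def on_subintervals_def by blast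
    then show ?thesis using that halves[of k] unfolding small_def by (intro bisect) auto
  qed
  have "\<exists>K. small K"
  proof (rule ccontr)
    assume "\<not> (\<exists>K. small K)"
    have large: "\<epsilon> \<le> \<beta> (a k) (b k)" for k
    proof -
      obtain j where j: "j \<in> {1..<length (p k)}" "\<epsilon> \<le> \<beta> (p k ! (j - 1)) (p k ! j)"
        using \<open>\<not> (\<exists>K. small K)\<close> unfolding small_def on_subintervals_def by force
      then show ?thesis
        using maximal[OF j(1)] by (simp add: \<beta>_def a_def b_def subinterval_bound_def)
    qed
    obtain D where "D > 0" and D0: "on_subintervals (\<lambda>a b. \<bar>f' a - f' b\<bar> \<le> D) (p 0)"
      by (rule on_subintervals_uniform_bound)
    have D: "on_subintervals (\<lambda>a b. \<bar>f' a - f' b\<bar> \<le> D) (p k)" for k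
    proof (induction k)
      case (Suc k)
      then have "\<bar>f' (a k) - f' (b k)\<bar> \<le> D"
        using i unfolding a_def b_def on_subintervals_def by blast
      then show ?case using Suc jump[of k] by (intro bisect) auto
    qed (rule D0)
    have wide: "4 * \<epsilon> / D \<le> b k - a k" for k
    proof -
      have "\<bar>f' (a k) - f' (b k)\<bar> \<le> D"
        using D i unfolding a_def b_def on_subintervals_def by blast
      then have "(b k - a k) * \<bar>f' (a k) - f' (b k)\<bar> \<le> (b k - a k) * D"
        using ab[of k] by (intro mult_left_mono) auto
      then show ?thesis using large[of k] \<open>D > 0\<close> by (simp add: \<beta>_def field_simps)
    qed
    \<comment> \<open>A bound \<open>E\<close> on the reciprocal widths gives a positive lower bound on the widths.\<close>
    obtain E where "E > 0" and E: "on_subintervals (\<lambda>a b. 1 / (b - a) \<le> E) (p 0)"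
      by (rule on_subintervals_uniform_bound)
    \<comment> \<open>Initial widths are at least \<open>1 / E\<close>; a new half is at least half of \<open>4 * \<epsilon> / D\<close>.\<close>
    define c where "c = min (1 / E) (2 * \<epsilon> / D)"
    have "c > 0" using \<open>E > 0\<close> \<open>D > 0\<close> \<open>\<epsilon> > 0\<close> by (simp add: c_def)
    have width: "on_subintervals (\<lambda>a b. c \<le> b - a) (p k)" for k
    proof (induction k)
      case 0
      have "1 / E \<le> p 0 ! j - p 0 ! (j - 1)" if "j \<in> {1..<length (p 0)}" for j
        using on_subintervalsD[OF E that] is_partition_subinterval(2)[OF init(1) that] \<open>E > 0\<close>
        by (simp add: field_simps)
      then show ?case unfolding on_subintervals_def c_def by (simp add: min.coboundedI1)
    next
      case (Suc k)
      have "c \<le> (b k - a k) / 2" using wide[of k] unfolding c_def by simp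
      then show ?case using Suc m(1,2)[of k] by (intro bisect) auto
    qed
    have len: "length (p k) = length (p 0) + k" for k
      by (induction k) (auto simp: eq length_bisect)
    have "length (p 0) \<ge> 1" using i[of 0] by auto
    then have many: "real k \<le> real (card {1..<length (p k)})" for k using len[of k] by simp
    have "real k * c \<le> u - l" for k
    proof -
      have "real k * c \<le> real (card {1..<length (p k)}) * c"
        using many[of k] \<open>c > 0\<close> by (intro mult_right_mono) auto
      also have "\<dots> \<le> (\<Sum>j\<in>{1..<length (p k)}. p k ! j - p k ! (j - 1))"
        using on_subintervalsD[OF width[of k]] by (intro sum_bounded_below) auto
      also have "\<dots> = u - l" using inv is_partition_width_sum by blast
      finally show ?thesis .
    qed
    moreover obtain n where "u - l < real n * c" using reals_Archimedean3[OF \<open>c > 0\<close>] by blast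
    ultimately show False by (meson not_le)
  qed
  then obtain K where "small K" by blast
  have "small k" if "K \<le> k" for k
    using that by (induction k rule: dec_induct) (use \<open>small K\<close> small_Suc in auto)
  then show ?thesis
    unfolding eventually_sequentially small_def on_subintervals_def \<beta>_def subinterval_bound_def
    by blast
qed

section \<open>Hausdorff convergence\<close>

text \<open>
  Nonnegativity also depends on the hypotheses: a supremum of reals is only meaningful when bounded
  above, and \<open>e\<close> provides the bound.
\<close>

lemma hausdorff_distance_le:
  assumes "A \<noteq> {}" "B \<noteq> {}"
    and AB: "\<And>a. a \<in> A \<Longrightarrow> \<exists>b\<in>B. dist a b \<le> e"
    and BA: "\<And>b. b \<in> B \<Longrightarrow> \<exists>a\<in>A. dist a b \<le> e"
  shows "0 \<le> hausdorff_distance A B" "hausdorff_distance A B \<le> e"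
proof -
  have bdd: "bdd_below ((\<lambda>b. dist a b) ` B)" "bdd_below ((\<lambda>a. dist a c) ` A)" for a c
    by (auto intro: bdd_belowI[of _ 0])
  have infA: "(INF b\<in>B. dist a b) \<le> e" if "a \<in> A" for a
    using AB[OF that] bdd(1) by (auto intro: cINF_lower2)
  have infB: "(INF a\<in>A. dist a b) \<le> e" if "b \<in> B" for b
    using BA[OF that] bdd(2) by (auto intro: cINF_lower2)
  show "hausdorff_distance A B \<le> e"
    unfolding hausdorff_distance_def using infA infB assms(1,2) by (auto intro!: cSUP_least)
  obtain a where "a \<in> A" using assms(1) by blast
  moreover have "0 \<le> (INF b\<in>B. dist a b)" using assms(2) by (intro cINF_greatest) auto
  moreover have "bdd_above ((\<lambda>a. INF b\<in>B. dist a b) ` A)" using infA by (intro bdd_aboveI2[of _ _ e]) blast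
  ultimately have "0 \<le> (SUP a\<in>A. INF b\<in>B. dist a b)" by (intro cSUP_upper2)
  then show "0 \<le> hausdorff_distance A B" unfolding hausdorff_distance_def by simp
qed

theorem corollary1:
  fixes f f' :: "real \<Rightarrow> real" and l u :: real
    and p :: "nat \<Rightarrow> real list" and w :: "nat \<Rightarrow> nat \<Rightarrow> real \<times> real"
  assumes "l < u"
    and nonlinear: "\<not> (\<exists>a b. \<forall>x\<in>{l..u}. f x = a * x + b)"
    and bounded: "bounded (f ` {l..u})"
    and differentiable: "\<And>x. x \<in> {l..u} \<Longrightarrow> (f has_real_derivative f' x) (at x within {l..u})"
    and base: "base_partition f f' l u (p 0)"
    and curvature: "\<And>i. i \<in> {1..<length (p 0)} \<Longrightarrow>
          convex_on {p 0 ! (i - 1)..p 0 ! i} f \<or> concave_on {p 0 ! (i - 1)..p 0 ! i} f"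
    and procedure: "\<And>k. max_bound_step f' (p k) (p (Suc k))"
    and apex: "\<And>k i. i \<in> {1..<length (p k)} \<Longrightarrow>
          tangent_intersection f f' (p k ! (i - 1)) (p k ! i) (w k i)"
  shows "(\<lambda>k. hausdorff_distance (proj_xy (milp_formulation f (p k) (w k)))
                                 {(x, y). x \<in> {l..u} \<and> y = f x}) \<longlonglongrightarrow> 0"
proof -
  let ?X = "{(x, y). x \<in> {l..u} \<and> y = f x}"
  let ?R = "\<lambda>k. proj_xy (milp_formulation f (p k) (w k))"
  have part0: "is_partition l u (p 0)"
    using base by (simp add: base_partition_def pre_base_partition_def)
  have der: "(f has_real_derivative f' x) (at x within {a..b})"
    if "l \<le> a" "b \<le> u" "x \<in> {a..b}" for a b x
    using that by (intro DERIV_subset[OF differentiable]) auto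
  have mono0: "on_subintervals (monotone_between f') (p 0)"
    unfolding on_subintervals_def
  proof
    fix i assume i: "i \<in> {1..<length (p 0)}"
    note der_i = der[OF is_partition_subinterval(1,3)[OF part0 i]]
    show "monotone_between f' (p 0 ! (i - 1)) (p 0 ! i)"
      using curvature[OF i] convex_on_imp_mono_derivative[OF _ der_i]
        concave_on_imp_antimono_derivative[OF _ der_i]
      unfolding monotone_between_def by blast
  qed
  have part: "is_partition l u (p k)" and mono: "on_subintervals (monotone_between f') (p k)" for k
    using max_bound_procedure_invariant[OF procedure part0 mono0] by auto
  \<comment> \<open>The constant 8 is the factor 2 of \<open>tangent_triangle_near_graph\<close> times the 4 in the denominator
    of \<open>subinterval_bound\<close>.\<close>
  have close: "0 \<le> hausdorff_distance (?R k) ?X \<and> hausdorff_distance (?R k) ?X \<le> 8 * \<epsilon>"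
    if small: "\<forall>i\<in>{1..<length (p k)}. subinterval_bound f' (p k) i < \<epsilon>" for k \<epsilon>
  proof -
    let ?T = "\<lambda>i. convex hull {graph_point f (p k ! (i - 1)), w k i, graph_point f (p k ! i)}"
    have R: "?R k = (\<Union>i\<in>{1..<length (p k)}. ?T i)"
      by (rule proj_milp_formulation[OF is_partition_length_ge_2[OF part \<open>l < u\<close>]])
    have near: "fst q \<in> {p k ! (i - 1)..p k ! i}" "fst q \<in> {l..u}"
      "dist q (fst q, f (fst q)) \<le> 8 * \<epsilon>"
      if i: "i \<in> {1..<length (p k)}" and q: "q \<in> ?T i" for i q
    proof -
      note sub = is_partition_subinterval[OF part i]
      note tri = tangent_triangle_near_graph[OF sub(2) der[OF sub(1,3)] on_subintervalsD[OF mono i]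
          apex[OF i] q]
      show "fst q \<in> {p k ! (i - 1)..p k ! i}" by (rule tri(1))
      then show "fst q \<in> {l..u}" using sub by auto
      have "dist q (fst q, f (fst q)) = \<bar>snd q - f (fst q)\<bar>"
        by (simp add: dist_prod_def dist_real_def)
      also have "\<dots> \<le> 8 * subinterval_bound f' (p k) i"
        using tri(2) by (simp add: subinterval_bound_def)
      also have "\<dots> \<le> 8 * \<epsilon>" using small i by (simp add: less_imp_le)
      finally show "dist q (fst q, f (fst q)) \<le> 8 * \<epsilon>" .
    qed
    \<comment> \<open>The point of the chord above \<open>x\<close> serves as the witness near \<open>(x, f x)\<close>.\<close>
    have over: "\<exists>q\<in>?R k. dist q (x, f x) \<le> 8 * \<epsilon>" if x: "x \<in> {l..u}" for x
    proof -
      obtain i where i: "i \<in> {1..<length (p k)}" and xi: "x \<in> {p k ! (i - 1)..p k ! i}"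
        using is_partition_covers[OF part \<open>l < u\<close> x] by blast
      let ?a = "p k ! (i - 1)" and ?b = "p k ! i"
      have "x \<in> closed_segment ?a ?b" using xi by (simp add: closed_segment_eq_real_ivl)
      then obtain t where t: "0 \<le> t" "t \<le> 1" "x = (1 - t) *\<^sub>R ?a + t *\<^sub>R ?b"
        by (auto simp: closed_segment_def)
      define q where "q = (1 - t) *\<^sub>R graph_point f ?a + t *\<^sub>R graph_point f ?b"
      have "q \<in> closed_segment (graph_point f ?a) (graph_point f ?b)"
        using t by (auto simp: q_def closed_segment_def)
      then have "q \<in> ?T i"
        unfolding segment_convex_hull
        using hull_mono[of "{graph_point f ?a, graph_point f ?b}"
            "{graph_point f ?a, w k i, graph_point f ?b}" convex] by auto
      moreover have "fst q = x" by (simp add: q_def graph_point_def t(3))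
      ultimately have "dist q (x, f x) \<le> 8 * \<epsilon>" using near(3)[OF i] by metis
      moreover have "q \<in> ?R k" unfolding R using \<open>q \<in> ?T i\<close> i by blast
      ultimately show ?thesis by blast
    qed
    have "?X \<noteq> {}" using \<open>l < u\<close> by auto
    moreover have "?R k \<noteq> {}" using over[of l] \<open>l < u\<close> by auto
    moreover have "\<exists>b\<in>?X. dist q b \<le> 8 * \<epsilon>" if q: "q \<in> ?R k" for q
    proof -
      obtain i where "i \<in> {1..<length (p k)}" "q \<in> ?T i" using q unfolding R by blast
      then show ?thesis using near by (intro bexI[of _ "(fst q, f (fst q))"]) auto
    qed
    moreover have "\<exists>q\<in>?R k. dist q b \<le> 8 * \<epsilon>" if "b \<in> ?X" for b
      using that over by auto
    ultimately show ?thesis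
      using hausdorff_distance_le[of "?R k" ?X "8 * \<epsilon>"] by blast
  qed
  show ?thesis
  proof (rule tendstoI)
    fix e :: real assume "e > 0"
    then have "\<forall>\<^sub>F k in sequentially. \<forall>i\<in>{1..<length (p k)}. subinterval_bound f' (p k) i < e / 16"
      using max_bound_eventually_less[where \<epsilon> = "e / 16", OF procedure part0 mono0] by simp
    then show "\<forall>\<^sub>F k in sequentially. dist (hausdorff_distance (?R k) ?X) 0 < e"
    proof eventually_elim
      case (elim k)
      then show ?case using close[OF elim] \<open>e > 0\<close> by simp
    qed
  qed
qed

end
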